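(* (1) Let $k_1,m_1,k_2,m_2,k_3,m_3\in\mathbb{N}$ and $\alpha\in\mathbb{Q}$ with $0^{k_1}1^{m_1}0^{k_2}1^{m_2}0^{k_3}1^{m_3}(\alpha)=1$. Then $$\alpha=\left[\frac{2}{3}\right]^{m_{3}}\left(2^{k_{3}}\left(\left[\frac{2}{3}\right]^{m_{2}}\left(2^{k_{2}}\left(\left[\frac{2}{3}\right]^{m_{1}}\left(2^{k_{1}}+1\right)-1\right)+1\right)-1\right)+1\right)-1.$$ (2) Furthermore, for all $l_1,l_2,l_3,m_1,m_2,m_3\in\mathbb{N}$, if $$k_3=2l_3\cdot 3^{m_3-1},\qquad k_2=2l_2\cdot 3^{m_2+m_3-1},\qquad k_1=(2l_1-1)\cdot 3^{m_1+m_2+m_3-1},$$ then the number $\alpha$ given by the formula in (1) is a solution in $\mathbb{N}$, i.e. $\alpha\in\mathbb{N}$ and $0^{k_1}1^{m_1}0^{k_2}1^{m_2}0^{k_3}1^{m_3}(\alpha)=1$.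
   Context: $\mathbb{N}=\{1,2,3,\ldots\}$. The symbols $0$ and $1$, when used as letters in a word applied to a number, denote the maps $0:x\mapsto \frac{x}{2}$ and $1:x\mapsto\frac{3x+1}{2}$, here regarded as maps $\mathbb{Q}\to\mathbb{Q}$. Words denote compositions read from right to left (the rightmost letter is applied first), and $s^k$ denotes the $k$-fold composition of $s$ with itself; thus in $0^{k_1}1^{m_1}0^{k_2}1^{m_2}0^{k_3}1^{m_3}(\alpha)$ one first applies $1$ exactly $m_3$ times to $\alpha$, then $0$ exactly $k_3$ times, and so on, ending with $k_1$ applications of $0$. Square brackets are ordinary parentheses. *)

theory Defs
  imports Complex_Main
begin

definition map0 :: "rat \<Rightarrow> rat" where
  "map0 x = x / 2"

definition map1 :: "rat \<Rightarrow> rat" where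
  "map1 x = (3 * x + 1) / 2"

text \<open>Words are read from right to left, so juxtaposition is \<open>\<circ>\<close> and \<open>s\<^sup>k\<close> is \<open>s ^^ k\<close>.\<close>

definition word3 :: "nat \<Rightarrow> nat \<Rightarrow> nat \<Rightarrow> nat \<Rightarrow> nat \<Rightarrow> nat \<Rightarrow> rat \<Rightarrow> rat" where
  "word3 k1 m1 k2 m2 k3 m3 =
     (map0 ^^ k1) \<circ> (map1 ^^ m1) \<circ> (map0 ^^ k2) \<circ> (map1 ^^ m2) \<circ> (map0 ^^ k3) \<circ> (map1 ^^ m3)"

definition start3 :: "nat \<Rightarrow> nat \<Rightarrow> nat \<Rightarrow> nat \<Rightarrow> nat \<Rightarrow> nat \<Rightarrow> rat" where
  "start3 k1 m1 k2 m2 k3 m3 =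
     (2/3) ^ m3 * (2 ^ k3 * ((2/3) ^ m2 * (2 ^ k2 * ((2/3) ^ m1 * (2 ^ k1 + 1) - 1) + 1) - 1) + 1) - 1"

end

theory Submission
  imports Defs "HOL-Number_Theory.Cong"
begin

text \<open>Since \<open>1\<close> is \<open>x + 1 \<mapsto> 3 (x + 1) / 2\<close>, both maps are easily iterated and inverted, which gives
  the formula as an equivalence. For integrality, \<open>2\<close> to the power \<open>3 ^ n\<close> is \<open>-1\<close> modulo
  \<open>3 ^ (n + 1)\<close>; so the number reached after undoing each block \<open>0 ^ k 1 ^ m\<close> is a positive
  integer congruent to \<open>-1\<close> modulo the powers of \<open>3\<close> still to be divided out.\<close>

lemma funpow_map0: "(map0 ^^ k) x = x / 2 ^ k"
  by (induction k) (simp_all add: map0_def)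

lemma funpow_map1: "(map1 ^^ m) x = (3/2) ^ m * (x + 1) - 1"
  by (induction m) (simp_all add: map1_def field_simps)

lemma funpow_map0_eq_iff: "(map0 ^^ k) x = y \<longleftrightarrow> x = 2 ^ k * y"
  by (auto simp: funpow_map0 field_simps)

lemma funpow_map1_eq_iff: "(map1 ^^ m) x = y \<longleftrightarrow> x = (2/3) ^ m * (y + 1) - 1"
  by (auto simp: funpow_map1 field_simps)

lemma word3_eq_1_iff:
  "word3 k1 m1 k2 m2 k3 m3 \<alpha> = 1 \<longleftrightarrow> \<alpha> = start3 k1 m1 k2 m2 k3 m3"
  by (simp add: word3_def start3_def funpow_map0_eq_iff funpow_map1_eq_iff)

text \<open>Lifting by cubing: in \<open>x ^ 3 + 1 = (x + 1) * (x ^ 2 - x + 1)\<close> the second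
  factor is divisible by 3 as soon as \<open>x + 1\<close> is, so each cubing gains a factor
  3.\<close>

lemma cong_2_power_3_power: "[2 ^ 3 ^ n = -1] (mod (3 ^ Suc n :: int))"
proof (induction n)
  case 0
  show ?case by (simp add: cong_def)
next
  case (Suc n)
  define x :: int where "x = 2 ^ 3 ^ n"
  have div: "3 ^ Suc n dvd x + 1"
    using Suc by (simp add: x_def cong_iff_dvd_diff)
  then have "3 dvd x + 1"
    by (meson dvd_power dvd_trans zero_less_Suc)
  \<comment> \<open>This is \<open>x ^ 2 - x + 1\<close>, written so that divisibility by 3 can be
    read off.\<close>
  then have "3 dvd (x + 1) * (x - 2) + 3"
    by simp
  then have "3 ^ Suc n * 3 dvd (x + 1) * ((x + 1) * (x - 2) + 3)"
    using div by (intro mult_dvd_mono)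
  also have "(x + 1) * ((x + 1) * (x - 2) + 3) = x ^ 3 + 1"
    by (simp add: algebra_simps power3_eq_cube)
  also have "x ^ 3 = 2 ^ 3 ^ Suc n"
    by (simp add: x_def mult.commute flip: power_mult)
  finally show ?case
    by (simp add: cong_iff_dvd_diff mult.commute)
qed

text \<open>The parity of \<open>c\<close> selects the sign: the even multiples in \<open>k2\<close>
  and \<open>k3\<close> give 1, the odd one in \<open>k1\<close> gives -1.\<close>

lemma cong_2_power_mult_3_power:
  assumes "M \<ge> 1"
  shows "[2 ^ (c * 3 ^ (M - 1)) = (-1) ^ c] (mod (3 ^ M :: int))"
proof -
  have "[(2 ^ 3 ^ (M - 1)) ^ c = (-1) ^ c] (mod (3 ^ M :: int))"
    using cong_pow[OF cong_2_power_3_power[of "M - 1"]] assms by simp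
  then show ?thesis
    by (simp add: mult.commute flip: power_mult)
qed

text \<open>Of the \<open>m + M\<close> factors 3 in \<open>N + 1\<close>, \<open>m\<close> cancel
  the denominator of \<open>(2/3) ^ m\<close> and \<open>M\<close> survive in \<open>A + 1\<close>
  for the later blocks.\<close>

lemma undo_map1_integral:
  fixes N :: int
  assumes "m \<ge> 1" "N \<ge> 1" "[N = -1] (mod 3 ^ (m + M))"
  obtains A :: int where "A \<ge> 1" "[A = -1] (mod 3 ^ M)"
    "(of_int A :: rat) = (2/3) ^ m * (of_int N + 1) - 1"
proof -
  obtain q where q: "N + 1 = 3 ^ (m + M) * q"
    using assms(3) by (auto simp: cong_iff_dvd_diff)
  have "0 < 3 ^ (m + M) * q"
    using q assms(2) by linarith
  then have "q > 0"
    by (simp add: zero_less_mult_iff)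
  define A where "A = 2 ^ m * 3 ^ M * q - 1"
  \<comment> \<open>A factor 2 is needed for \<open>A\<close> to remain positive after subtracting
    1.\<close>
  have "(2::int) ^ 1 \<le> 2 ^ m"
    using assms(1) by (intro power_increasing) auto
  then have "2 * 1 \<le> 2 ^ m * (3 ^ M * q)"
    using \<open>q > 0\<close> by (intro mult_mono) (auto simp: int_one_le_iff_zero_less)
  then have "A \<ge> 1"
    by (simp add: A_def mult.assoc)
  moreover have "[A = -1] (mod 3 ^ M)"
    by (simp add: A_def cong_iff_dvd_diff)
  moreover have "(of_int N + 1 :: rat) = of_int (3 ^ (m + M) * q)"
    by (simp flip: q)
  then have "(of_int A :: rat) = (2/3) ^ m * (of_int N + 1) - 1"
    by (simp add: A_def power_add power_divide)
  ultimately show thesis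
    using that by blast
qed

text \<open>The even multiple makes \<open>2 ^ k\<close> congruent to 1, so undoing the halvings
  keeps the residue -1.\<close>

lemma undo_block_integral:
  fixes A :: int
  assumes "m \<ge> 1" "A \<ge> 1" "[A = -1] (mod 3 ^ (m + M))" "k = 2 * l * 3 ^ (m + M - 1)"
  obtains B :: int where "B \<ge> 1" "[B = -1] (mod 3 ^ M)"
    "(of_int B :: rat) = (2/3) ^ m * (2 ^ k * of_int A + 1) - 1"
proof -
  have "[2 ^ k = (-1) ^ (2 * l)] (mod (3 ^ (m + M) :: int))"
    unfolding assms(4) using assms(1) by (intro cong_2_power_mult_3_power) simp
  then have "[2 ^ k * A = 1 * (-1)] (mod 3 ^ (m + M))"
    using assms(3) by (intro cong_mult) simp_all
  moreover have "1 * 1 \<le> 2 ^ k * A"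
    using assms(2) by (intro mult_mono) auto
  ultimately show thesis
    using undo_map1_integral[OF assms(1), of "2 ^ k * A" M] that by auto
qed

lemma start3_integral:
  assumes "l1 \<ge> 1" "m1 \<ge> 1" "m2 \<ge> 1" "m3 \<ge> 1"
    and k3: "k3 = 2 * l3 * 3 ^ (m3 - 1)"
    and k2: "k2 = 2 * l2 * 3 ^ (m2 + m3 - 1)"
    and k1: "k1 = (2 * l1 - 1) * 3 ^ (m1 + m2 + m3 - 1)"
  obtains n :: nat where "n \<ge> 1" "start3 k1 m1 k2 m2 k3 m3 = of_nat n"
proof -
  \<comment> \<open>Undoing starts from 1 rather than from a number congruent to -1, so
    \<open>2 ^ k1\<close> itself has to supply the sign.\<close>
  have "odd (2 * l1 - 1)"
    using assms(1) by simp
  then have "[2 ^ k1 = -1] (mod (3 ^ (m1 + (m2 + m3)) :: int))"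
    using cong_2_power_mult_3_power[of "m1 + m2 + m3" "2 * l1 - 1"] assms(2)
    unfolding k1 by (simp add: add.assoc)
  then obtain A :: int where A: "A \<ge> 1" "[A = -1] (mod 3 ^ (m2 + m3))"
      "(of_int A :: rat) = (2/3) ^ m1 * (2 ^ k1 + 1) - 1"
    using undo_map1_integral[OF assms(2), of "2 ^ k1" "m2 + m3"] by auto
  obtain B :: int where B: "B \<ge> 1" "[B = -1] (mod 3 ^ m3)"
      "(of_int B :: rat) = (2/3) ^ m2 * (2 ^ k2 * of_int A + 1) - 1"
    using undo_block_integral[OF assms(3) A(1,2) k2] .
  \<comment> \<open>In the last block \<open>M = 0\<close>: all remaining factors 3 are used
    up.\<close>
  have "[B = -1] (mod 3 ^ (m3 + 0))" "k3 = 2 * l3 * 3 ^ (m3 + 0 - 1)"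
    using B(2) k3 by simp_all
  then obtain C :: int where C: "C \<ge> 1"
      "(of_int C :: rat) = (2/3) ^ m3 * (2 ^ k3 * of_int B + 1) - 1"
    using undo_block_integral[OF assms(4) B(1)] by metis
  have "start3 k1 m1 k2 m2 k3 m3 = of_int C"
    by (simp only: start3_def A(3) B(3) C(2))
  also have "\<dots> = of_nat (nat C)"
    using C(1) by simp
  finally show thesis
    using that[of "nat C"] C(1) by linarith
qed

theorem theorem4p2:
  shows "(\<forall>(k1::nat) (m1::nat) (k2::nat) (m2::nat) (k3::nat) (m3::nat) (\<alpha>::rat).
            k1 \<ge> 1 \<longrightarrow> m1 \<ge> 1 \<longrightarrow> k2 \<ge> 1 \<longrightarrow> m2 \<ge> 1 \<longrightarrow> k3 \<ge> 1 \<longrightarrow> m3 \<ge> 1 \<longrightarrow>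
            word3 k1 m1 k2 m2 k3 m3 \<alpha> = 1 \<longrightarrow> \<alpha> = start3 k1 m1 k2 m2 k3 m3)
       \<and> (\<forall>(l1::nat) (l2::nat) (l3::nat) (m1::nat) (m2::nat) (m3::nat) (k1::nat) (k2::nat) (k3::nat) (\<alpha>::rat).
            l1 \<ge> 1 \<longrightarrow> l2 \<ge> 1 \<longrightarrow> l3 \<ge> 1 \<longrightarrow> m1 \<ge> 1 \<longrightarrow> m2 \<ge> 1 \<longrightarrow> m3 \<ge> 1 \<longrightarrow>
            k3 = 2 * l3 * 3 ^ (m3 - 1) \<longrightarrow>
            k2 = 2 * l2 * 3 ^ (m2 + m3 - 1) \<longrightarrow>
            k1 = (2 * l1 - 1) * 3 ^ (m1 + m2 + m3 - 1) \<longrightarrow>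
            \<alpha> = start3 k1 m1 k2 m2 k3 m3 \<longrightarrow>
            (\<exists>n::nat. n \<ge> 1 \<and> \<alpha> = of_nat n) \<and> word3 k1 m1 k2 m2 k3 m3 \<alpha> = 1)"
  \<comment> \<open>Both claims about \<open>word3\<close> become trivial, leaving only integrality
    and positivity of \<alpha>.\<close>
  unfolding word3_eq_1_iff
proof (intro conjI allI impI)
  fix l1 l2 l3 m1 m2 m3 k1 k2 k3 :: nat and \<alpha> :: rat
  assume "l1 \<ge> 1" "m1 \<ge> 1" "m2 \<ge> 1" "m3 \<ge> 1"
    "k3 = 2 * l3 * 3 ^ (m3 - 1)" "k2 = 2 * l2 * 3 ^ (m2 + m3 - 1)"
    "k1 = (2 * l1 - 1) * 3 ^ (m1 + m2 + m3 - 1)"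
    and \<alpha>: "\<alpha> = start3 k1 m1 k2 m2 k3 m3"
  from this(1-7) obtain n :: nat where "n \<ge> 1" "start3 k1 m1 k2 m2 k3 m3 = of_nat n"
    by (rule start3_integral)
  then show "\<exists>n::nat. n \<ge> 1 \<and> \<alpha> = of_nat n"
    using \<alpha> by blast
qed

end
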